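(* Let $q$ be a prime power, let $k$ be a positive integer, and let $\mathcal F \subseteq \mathbb F_q[T] \setminus \{0\}$ be a set of size at most $q^k$. Then $\delta(\mathcal F) \ge q^{-k}$.
   Context: $\mathbb F_q$ is the field with $q$ elements and $\mathbb F_q((T^{-1}))$ is the field of formal Laurent series $\alpha = \sum_{i=-\infty}^{n} x_i T^i$ in $T^{-1}$. For such $\alpha$, $\mathrm{ord}(\alpha)$ is the greatest $i$ with $x_i \neq 0$, and $\langle \alpha \rangle = q^{\mathrm{ord}(\alpha)}$, with $\mathrm{ord}(0) = -\infty$ and $\langle 0 \rangle = 0$. Put $\mathbb T = \{\alpha \in \mathbb F_q((T^{-1})) : \langle \alpha \rangle < 1\}$. Each $\alpha$ decomposes uniquely as $\alpha = [\alpha] + \|\alpha\|$ with $[\alpha] \in \mathbb F_q[T]$ and $\|\alpha\| \in \mathbb T$; write $|\alpha| := \langle \|\alpha\| \rangle$. The loneliness of $\mathcal F \subseteq \mathbb F_q[T] \setminus \{0\}$ is $\delta(\mathcal F) := \sup_{\alpha \in \mathbb T} \min_{f \in \mathcal F} |\alpha f|$ (a minimum over the empty set is read as $+\infty$). *)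

theory Defs
  imports
    "HOL-Library.Cardinality"
    "HOL-Library.Extended_Real"
    "HOL-Computational_Algebra.Formal_Laurent_Series"
begin

notation fls_nth (infixl "$$" 75)

(* The field with q elements is a type 'a :: {field, finite} with q = CARD('a).
   The field F_q((T^{-1})) is 'a fls with formal variable fls_X = T^{-1}; thus T is fls_X_inv,
   and the coefficient of T^i in \<alpha> is \<alpha> $$ (-i). *)

definition poly_to_ls :: "'a::field poly \<Rightarrow> 'a fls" where
  "poly_to_ls p = poly (map_poly fls_const p) fls_X_inv"

(* The greatest i such that the coefficient of T^i is nonzero. The value at 0, which should be
   minus infinity, is irrelevant: ls_abs treats 0 separately. *)
definition ls_ord :: "'a::field fls \<Rightarrow> int" where
  "ls_ord \<alpha> = - fls_subdegree \<alpha>"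

definition ls_abs :: "'a::{field,finite} fls \<Rightarrow> real" where
  "ls_abs \<alpha> = (if \<alpha> = 0 then 0 else real CARD('a) powi ls_ord \<alpha>)"

definition ls_torus :: "'a::{field,finite} fls set" where
  "ls_torus = {\<alpha>. ls_abs \<alpha> < 1}"

(* Well defined by lemma ls_decomposition_unique below. *)
definition ls_frac :: "'a::{field,finite} fls \<Rightarrow> 'a fls" where
  "ls_frac \<alpha> = (THE \<beta>. \<beta> \<in> ls_torus \<and> (\<exists>p. \<alpha> = poly_to_ls p + \<beta>))"

definition ls_dist :: "'a::{field,finite} fls \<Rightarrow> real" where
  "ls_dist \<alpha> = ls_abs (ls_frac \<alpha>)"

(* For finite nonempty F the infimum is a minimum; for empty F it is \<infinity>, as required. *)
definition loneliness :: "'a::{field,finite} poly set \<Rightarrow> ereal" where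
  "loneliness F = (SUP \<alpha>\<in>ls_torus. INF f\<in>F. ereal (ls_dist (\<alpha> * poly_to_ls f)))"

lemma poly_to_ls_nth:
  "poly_to_ls p $$ n = (if n \<le> 0 then coeff p (nat (- n)) else 0)"
proof -
  have "poly_to_ls p = (\<Sum>i\<le>degree p. fls_const (coeff p i) * fls_X_inv ^ i)"
    unfolding poly_to_ls_def poly_altdef
    by (subst degree_map_poly) (auto simp: coeff_map_poly)
  then have "poly_to_ls p $$ n = (\<Sum>i\<le>degree p. if n = - int i then coeff p i else 0)"
    by (simp add: fls_nth_sum if_distrib cong: if_cong)
  also have "\<dots> = (if n \<le> 0 then coeff p (nat (- n)) else 0)"
  proof (cases "n \<le> 0")
    case True
    then have "(n = - int i) = (nat (- n) = i)" for i by auto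
    then show ?thesis using True by (simp add: coeff_eq_0)
  next
    case False
    then show ?thesis by (intro trans[OF sum.neutral]) auto
  qed
  finally show ?thesis .
qed

lemma ls_torus_iff: "\<alpha> \<in> ls_torus \<longleftrightarrow> (\<forall>n\<le>0. \<alpha> $$ n = 0)"
proof (cases "\<alpha> = 0")
  case False
  have "card {0, 1::'a} \<le> CARD('a)" by (rule card_mono) auto
  then have q: "real CARD('a) > 1" by simp
  have "\<alpha> \<in> ls_torus \<longleftrightarrow> real CARD('a) powi ls_ord \<alpha> < real CARD('a) powi 0"
    using False by (simp add: ls_torus_def ls_abs_def)
  also have "\<dots> \<longleftrightarrow> ls_ord \<alpha> < 0"
    using q by (metis linorder_not_less nless_le power_int_strict_increasing power_int_increasing)
  also have "\<dots> \<longleftrightarrow> 1 \<le> fls_subdegree \<alpha>"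
    by (auto simp: ls_ord_def)
  also have "\<dots> \<longleftrightarrow> (\<forall>n\<le>0. \<alpha> $$ n = 0)"
    using False by (auto intro: fls_subdegree_geI)
  finally show ?thesis .
qed (simp add: ls_torus_def ls_abs_def)

lemma ls_decomposition_unique:
  fixes \<alpha> :: "'a::{field,finite} fls"
  shows "\<exists>!(p, \<beta>). \<beta> \<in> ls_torus \<and> \<alpha> = poly_to_ls p + \<beta>"
proof -
  define p0 where "p0 = fls_prpart \<alpha> + [:\<alpha> $$ 0:]"
  have c: "coeff p0 n = \<alpha> $$ (- int n)" for n
    by (cases n) (auto simp: p0_def)
  have ex: "\<alpha> - poly_to_ls p0 \<in> ls_torus"
    by (auto simp: ls_torus_iff poly_to_ls_nth c)
  have un: "p = p0" if "\<beta> \<in> ls_torus" "\<alpha> = poly_to_ls p + \<beta>" for p \<beta>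
  proof (rule poly_eqI)
    fix n show "coeff p n = coeff p0 n"
      using that by (simp add: c ls_torus_iff poly_to_ls_nth)
  qed
  show ?thesis
  proof (rule ex1I[of _ "(p0, \<alpha> - poly_to_ls p0)"])
    show "case (p0, \<alpha> - poly_to_ls p0) of (p, \<beta>) \<Rightarrow> \<beta> \<in> ls_torus \<and> \<alpha> = poly_to_ls p + \<beta>"
      using ex by simp
  next
    fix x assume "case x of (p, \<beta>) \<Rightarrow> \<beta> \<in> ls_torus \<and> \<alpha> = poly_to_ls p + \<beta>"
    then show "x = (p0, \<alpha> - poly_to_ls p0)"
      using un by (cases x) auto
  qed
qed

lemma ls_frac_nth: "ls_frac \<alpha> $$ n = (if n \<le> 0 then 0 else \<alpha> $$ n)"
proof -
  have ex1: "\<exists>!\<beta>. \<beta> \<in> ls_torus \<and> (\<exists>p. \<alpha> = poly_to_ls p + \<beta>)"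
    using ls_decomposition_unique[of \<alpha>] by (auto simp: Ex1_def)
  obtain p where "ls_frac \<alpha> \<in> ls_torus" "\<alpha> = poly_to_ls p + ls_frac \<alpha>"
    using theI'[OF ex1, folded ls_frac_def] by blast
  then have "\<alpha> $$ n = poly_to_ls p $$ n + ls_frac \<alpha> $$ n" "\<forall>n\<le>0. ls_frac \<alpha> $$ n = 0"
    by (metis fls_plus_nth, simp add: ls_torus_iff)
  then show ?thesis by (simp add: poly_to_ls_nth)
qed

end

theory Submission
  imports Defs
begin

text \<open>
  The bound is a counting argument.  For nonzero \<open>f\<close> of degree \<open>d\<close>, the inequality
  \<open>|\<alpha> f| < q\<^sup>-\<^sup>k\<close> says that the coefficients of \<open>T\<^sup>-\<^sup>1, \<dots>, T\<^sup>-\<^sup>k\<close> in \<open>\<alpha> f\<close>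
  vanish, which is a system of \<open>k\<close> linear equations in the coefficients of \<open>\<alpha>\<close>.  Since the
  \<open>j\<close>-th equation contains the coefficient of \<open>T\<close> to the power \<open>-(d+j)\<close> multiplied by the leading
  coefficient of \<open>f\<close>, and otherwise only coefficients of higher powers of \<open>T\<close>, the system is
  triangular: the coefficients at positions outside \<open>{d+1..d+k}\<close> determine a solution
  (\<open>inj_on_lonely_fail\<close>).  Hence if \<open>\<alpha>\<close> ranges over the \<open>q\<^sup>N\<close> sums of multiples of
  \<open>T\<^sup>-\<^sup>1, \<dots>, T\<^sup>-\<^sup>N\<close>, with \<open>N\<close> at least \<open>d + k\<close> for each \<open>f\<close> in the family, then each \<open>f\<close>
  excludes at most \<open>q\<^sup>N\<^sup>-\<^sup>k\<close> of them (\<open>card_lonely_fail_le\<close>).  As \<open>\<alpha> = 0\<close> is excluded by every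
  \<open>f\<close>, at most \<open>1 + q\<^sup>k (q\<^sup>N\<^sup>-\<^sup>k - 1) < q\<^sup>N\<close> series are excluded in total, so that some \<open>\<alpha>\<close>
  satisfies \<open>|\<alpha> f| \<ge> q\<^sup>-\<^sup>k\<close> for all \<open>f\<close> at once.
\<close>

text \<open>
  The coefficient of \<open>T\<^sup>-\<^sup>j\<close> in \<open>\<alpha> f\<close> when \<open>a n\<close> is the coefficient of \<open>T\<^sup>-\<^sup>n\<close> in \<open>\<alpha>\<close>.
\<close>
definition prod_coeff :: "'a::field poly \<Rightarrow> (nat \<Rightarrow> 'a) \<Rightarrow> nat \<Rightarrow> 'a" where
  "prod_coeff f a j = (\<Sum>i\<le>degree f. coeff f i * a (i + j))"

text \<open>
  The coefficient vectors of the series \<open>\<alpha>\<close> supported on \<open>T\<^sup>-\<^sup>1, \<dots>, T\<^sup>-\<^sup>N\<close> for which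
  \<open>|\<alpha> f| < q\<^sup>-\<^sup>k\<close>.  This reading requires \<open>degree f + k \<le> N\<close>: the sums then inspect the vectors on
  \<open>{1..N}\<close> only, and the default value of extensional functions plays no role.
\<close>
definition lonely_fail :: "nat \<Rightarrow> nat \<Rightarrow> 'a::field poly \<Rightarrow> (nat \<Rightarrow> 'a) set" where
  "lonely_fail N k f = {a \<in> {1..N} \<rightarrow>\<^sub>E UNIV. \<forall>j\<in>{1..k}. prod_coeff f a j = 0}"

lemma inj_on_lonely_fail:
  fixes f :: "'a::field poly"
  assumes "f \<noteq> 0"
  shows "inj_on (\<lambda>a. restrict a ({1..N} - {degree f + 1..degree f + k})) (lonely_fail N k f)"
proof (rule inj_onI)
  let ?d = "degree f"
  let ?S = "{1..N} - {?d + 1..?d + k}"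
  fix a b
  assume a: "a \<in> lonely_fail N k f" and b: "b \<in> lonely_fail N k f"
    and r: "restrict a ?S = restrict b ?S"
  have "a n = b n" for n
  proof (induction n rule: less_induct)
    case (less n)
    consider "n \<notin> {1..N}" | "n \<in> ?S" | "n \<in> {?d + 1..?d + k}" by blast
    then show ?case
    proof cases
      case 1
      then show ?thesis using a b unfolding lonely_fail_def by (auto simp: PiE_def extensional_def)
    next
      case 2
      then show ?thesis using r by (metis restrict_apply')
    next
      case 3
      \<comment> \<open>The equation with index \<open>n - d\<close> has \<open>a n\<close> as its last unknown.\<close>
      define j where "j = n - ?d"
      have j: "j \<in> {1..k}" "n = ?d + j" using 3 by (auto simp: j_def)
      have split: "prod_coeff f c j = (\<Sum>i<?d. coeff f i * c (i + j)) + lead_coeff f * c n" for c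
        by (simp add: prod_coeff_def j lessThan_Suc_atMost[symmetric])
      have "prod_coeff f a j = prod_coeff f b j"
        using a b j by (auto simp: lonely_fail_def)
      moreover have "(\<Sum>i<?d. coeff f i * a (i + j)) = (\<Sum>i<?d. coeff f i * b (i + j))"
        using less j by (intro sum.cong) auto
      ultimately show ?thesis using assms by (simp add: split)
    qed
  qed
  then show "a = b" by blast
qed

lemma card_lonely_fail_le:
  fixes f :: "'a::{field,finite} poly"
  assumes "f \<noteq> 0" "degree f + k \<le> N"
  shows "card (lonely_fail N k f) \<le> CARD('a) ^ (N - k)"
proof -
  let ?S = "{1..N} - {degree f + 1..degree f + k}"
  have "(\<lambda>a. restrict a ?S) ` lonely_fail N k f \<subseteq> ?S \<rightarrow>\<^sub>E UNIV"
    by (auto simp: PiE_def)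
  moreover have "finite (?S \<rightarrow>\<^sub>E (UNIV :: 'a set))" by (intro finite_PiE) auto
  ultimately have "card (lonely_fail N k f) \<le> card (?S \<rightarrow>\<^sub>E (UNIV :: 'a set))"
    by (rule card_inj_on_le[OF inj_on_lonely_fail[OF assms(1)]])
  also have "\<dots> = CARD('a) ^ (N - k)"
    using assms(2) by (subst card_PiE) (auto simp: card_Diff_subset)
  finally show ?thesis .
qed

lemma exists_no_lonely_fail:
  fixes F :: "'a::{field,finite} poly set"
  assumes F: "finite F" "0 \<notin> F" "card F \<le> CARD('a) ^ k" and "k \<ge> 1"
    and N: "k \<le> N" "\<And>f. f \<in> F \<Longrightarrow> degree f + k \<le> N"
  obtains a :: "nat \<Rightarrow> 'a"
  where "a \<in> {1..N} \<rightarrow>\<^sub>E UNIV" "\<And>f. f \<in> F \<Longrightarrow> a \<notin> lonely_fail N k f"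
proof -
  let ?q = "CARD('a)"
  let ?V = "{1..N} \<rightarrow>\<^sub>E (UNIV :: 'a set)"
  define z where "z = restrict (\<lambda>_. 0 :: 'a) {1..N}"
  have finV: "finite ?V" by (auto intro: finite_PiE)
  have finB: "finite (lonely_fail N k f)" for f :: "'a poly"
    by (rule finite_subset[OF _ finV]) (auto simp: lonely_fail_def)
  have z: "z \<in> lonely_fail N k f" if "f \<in> F" for f
    using N(2)[OF that] by (auto simp: z_def lonely_fail_def prod_coeff_def intro!: sum.neutral)
  \<comment> \<open>The vector \<open>z\<close> lies in every excluded set; counting it once makes the union bound strict.\<close>
  have "card (\<Union>f\<in>F. lonely_fail N k f - {z}) \<le> (\<Sum>f\<in>F. card (lonely_fail N k f - {z}))"
    by (rule card_UN_le[OF F(1)])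
  also have "\<dots> \<le> (\<Sum>f\<in>F. ?q ^ (N - k) - 1)"
  proof (rule sum_mono)
    fix f assume f: "f \<in> F"
    then have "f \<noteq> 0" using F by auto
    from card_lonely_fail_le[OF this N(2)[OF f]] z[OF f] finB[of f]
    show "card (lonely_fail N k f - {z}) \<le> ?q ^ (N - k) - 1"
      by (simp add: card_Diff_singleton)
  qed
  also have "\<dots> \<le> ?q ^ k * (?q ^ (N - k) - 1)"
    using F(3) by (simp add: mult_right_mono)
  also have "\<dots> = ?q ^ N - ?q ^ k"
    using N(1) by (simp add: diff_mult_distrib2 flip: power_add)
  finally have le: "card (\<Union>f\<in>F. lonely_fail N k f - {z}) \<le> ?q ^ N - ?q ^ k" .
  have "card {0, 1 :: 'a} \<le> ?q" by (rule card_mono) auto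
  then have q: "?q \<ge> 2" by simp
  have "card (insert z (\<Union>f\<in>F. lonely_fail N k f - {z})) \<le> Suc (?q ^ N - ?q ^ k)"
    by (rule card_insert_le_m1) (use le in simp_all)
  also have "\<dots> < ?q ^ N"
  proof -
    have "1 < ?q ^ k" using q \<open>k \<ge> 1\<close> by (intro one_less_power) auto
    moreover have "?q ^ k \<le> ?q ^ N" using q N by (intro power_increasing) auto
    ultimately show ?thesis by linarith
  qed
  also have "\<dots> = card ?V" by (subst card_PiE) auto
  finally have lt: "card (insert z (\<Union>f\<in>F. lonely_fail N k f - {z})) < card ?V" .
  have "finite (insert z (\<Union>f\<in>F. lonely_fail N k f - {z}))" using F(1) finB by auto
  then have "\<not> ?V \<subseteq> insert z (\<Union>f\<in>F. lonely_fail N k f - {z})"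
    using lt by (meson card_mono leD)
  then obtain a where "a \<in> ?V" "a \<notin> insert z (\<Union>f\<in>F. lonely_fail N k f - {z})"
    by blast
  then show thesis by (intro that[of a]) auto
qed

lemma times_poly_to_ls_nth:
  fixes \<alpha> :: "'a::field fls"
  shows "(\<alpha> * poly_to_ls f) $$ n = (\<Sum>i\<le>degree f. coeff f i * \<alpha> $$ (n + int i))"
proof -
  have "poly_to_ls f = (\<Sum>i\<le>degree f. fls_const (coeff f i) * fls_X_inv ^ i)"
    unfolding poly_to_ls_def poly_altdef
    by (subst degree_map_poly) (auto simp: coeff_map_poly)
  then have "\<alpha> * poly_to_ls f = (\<Sum>i\<le>degree f. fls_const (coeff f i) * (fls_X_inv ^ i * \<alpha>))"
    by (simp add: sum_distrib_left mult_ac)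
  then show ?thesis
    by (simp add: fls_nth_sum fls_X_inv_power_times_conv_shift)
qed

lemma ls_dist_ge:
  fixes \<alpha> :: "'a::{field,finite} fls"
  assumes "1 \<le> j" "j \<le> k" "\<alpha> $$ int j \<noteq> 0"
  shows "real CARD('a) powi (- int k) \<le> ls_dist \<alpha>"
proof -
  have nz: "ls_frac \<alpha> $$ int j \<noteq> 0" using assms by (simp add: ls_frac_nth)
  then have "fls_subdegree (ls_frac \<alpha>) \<le> int j" by (rule fls_subdegree_leI)
  then have "- int k \<le> ls_ord (ls_frac \<alpha>)" using assms by (simp add: ls_ord_def)
  moreover have "1 \<le> real CARD('a)" by (simp add: Suc_leI)
  ultimately have "real CARD('a) powi (- int k) \<le> real CARD('a) powi ls_ord (ls_frac \<alpha>)"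
    by (intro power_int_increasing) auto
  then show ?thesis using nz by (auto simp: ls_dist_def ls_abs_def)
qed

theorem theorem1p5:
  fixes F :: "'a::{field,finite} poly set" and q k :: nat
  assumes "CARD('a) = q"
    and "k \<ge> 1"
    and "0 \<notin> F"
    and "finite F" and "card F \<le> q ^ k"
  shows "loneliness F \<ge> ereal (real q powi (- int k))"
proof -
  define N where "N = (\<Sum>f\<in>F. degree f) + k"
  have N: "degree f + k \<le> N" if "f \<in> F" for f
    using that assms(4) by (simp add: N_def member_le_sum)
  obtain a where a: "a \<in> {1..N} \<rightarrow>\<^sub>E UNIV" "\<And>f. f \<in> F \<Longrightarrow> a \<notin> lonely_fail N k f"
    by (rule exists_no_lonely_fail[of F k N]) (use assms N in \<open>auto simp: N_def\<close>)
  define \<alpha> where "\<alpha> = fps_to_fls (Abs_fps (\<lambda>n. if n \<in> {1..N} then a n else 0))"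
  have \<alpha>: "\<alpha> \<in> ls_torus" by (auto simp: ls_torus_iff \<alpha>_def)
  have "ereal (real q powi (- int k)) \<le> ereal (ls_dist (\<alpha> * poly_to_ls f))" if f: "f \<in> F" for f
  proof -
    obtain j where j: "j \<in> {1..k}" "prod_coeff f a j \<noteq> 0"
      using a(1) a(2)[OF f] unfolding lonely_fail_def by blast
    have "\<alpha> $$ (int j + int i) = a (i + j)" if "i \<le> degree f" for i
      using that j N[OF f] by (auto simp: \<alpha>_def nat_add_distrib add.commute)
    then have "(\<alpha> * poly_to_ls f) $$ int j = prod_coeff f a j"
      by (simp add: times_poly_to_ls_nth prod_coeff_def)
    with j show ?thesis using ls_dist_ge[of j k "\<alpha> * poly_to_ls f"] assms(1) by auto
  qed
  then show ?thesis
    unfolding loneliness_def by (intro SUP_upper2[OF \<alpha>] INF_greatest)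
qed

end
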